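(* Let $m,n\ge 1$ be integers. Then $\hat f(m,n)=f(m,n)$.
   Context: The $m\times n$ board is an $m\times n$ rectangular grid of unit square cells; $\mathcal C$ is its set of cells. A height function is a map $h:\mathcal C\to\mathbb R$. Given a neighborhood relation on cells, the neighbors of a set $R\subseteq\mathcal C$ are the cells not in $R$ that have a neighbor in $R$, and a rectangular island of $h$ is a nonempty rectangular sub-board $R$ (all cells in a set of consecutive rows and a set of consecutive columns) such that the minimum of $h$ on $R$ is strictly greater than the maximum of $h$ on the neighbors of $R$; the entire board, having no neighbors, always counts as an island. $f(m,n)$ denotes the maximum, over all height functions $h$, of the number of rectangular islands of $h$ when two distinct cells are neighbors if and only if they share at least one point (a side or a corner). $\hat f(m,n)$ denotes the maximum, over all height functions $h$, of the number of rectangular islands of $h$ when two distinct cells are neighbors if and only if they have a side in common. *)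

theory Defs
  imports Complex_Main
begin

type_synonym cell = "nat \<times> nat"

text \<open>
  The cell \<open>(i, j)\<close> in row \<open>i\<close> and column \<open>j\<close> (both counted from 0) is the closed unit
  square \<open>[i, i+1] \<times> [j, j+1]\<close> of the plane.
\<close>

definition board :: "nat \<Rightarrow> nat \<Rightarrow> cell set" where
  "board m n = {..<m} \<times> {..<n}"

definition square :: "cell \<Rightarrow> (real \<times> real) set" where
  "square c = {real (fst c) .. real (fst c) + 1} \<times> {real (snd c) .. real (snd c) + 1}"

definition sides :: "cell \<Rightarrow> (real \<times> real) set set" where
  "sides c =
    {{real (fst c)} \<times> {real (snd c) .. real (snd c) + 1},
     {real (fst c) + 1} \<times> {real (snd c) .. real (snd c) + 1},
     {real (fst c) .. real (fst c) + 1} \<times> {real (snd c)},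
     {real (fst c) .. real (fst c) + 1} \<times> {real (snd c) + 1}}"

definition point_adjacent :: "cell \<Rightarrow> cell \<Rightarrow> bool" where
  "point_adjacent c d \<longleftrightarrow> c \<noteq> d \<and> square c \<inter> square d \<noteq> {}"

definition side_adjacent :: "cell \<Rightarrow> cell \<Rightarrow> bool" where
  "side_adjacent c d \<longleftrightarrow> c \<noteq> d \<and> sides c \<inter> sides d \<noteq> {}"

definition neighbors :: "(cell \<Rightarrow> cell \<Rightarrow> bool) \<Rightarrow> nat \<Rightarrow> nat \<Rightarrow> cell set \<Rightarrow> cell set" where
  "neighbors adj m n R = {c \<in> board m n - R. \<exists>d\<in>R. adj c d}"

definition subrectangle :: "nat \<Rightarrow> nat \<Rightarrow> cell set \<Rightarrow> bool" where
  "subrectangle m n R \<longleftrightarrow>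
    (\<exists>a b c d. a \<le> b \<and> b < m \<and> c \<le> d \<and> d < n \<and> R = {a..b} \<times> {c..d})"

text \<open>
  A height function is total on pairs of naturals, but only its values on the board are used.
  The maximum over an empty set of neighbors is undefined, so that case is listed separately.
\<close>

definition rectangular_island ::
    "(cell \<Rightarrow> cell \<Rightarrow> bool) \<Rightarrow> nat \<Rightarrow> nat \<Rightarrow> (cell \<Rightarrow> real) \<Rightarrow> cell set \<Rightarrow> bool" where
  "rectangular_island adj m n h R \<longleftrightarrow>
    subrectangle m n R \<and>
    (neighbors adj m n R = {} \<or> Min (h ` R) > Max (h ` neighbors adj m n R))"

definition num_islands ::
    "(cell \<Rightarrow> cell \<Rightarrow> bool) \<Rightarrow> nat \<Rightarrow> nat \<Rightarrow> (cell \<Rightarrow> real) \<Rightarrow> nat" where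
  "num_islands adj m n h = card {R. rectangular_island adj m n h R}"

definition max_islands :: "(cell \<Rightarrow> cell \<Rightarrow> bool) \<Rightarrow> nat \<Rightarrow> nat \<Rightarrow> nat" where
  "max_islands adj m n = Max {num_islands adj m n h | h. True}"

definition islands_f :: "nat \<Rightarrow> nat \<Rightarrow> nat" where
  "islands_f m n = max_islands point_adjacent m n"

definition islands_f_hat :: "nat \<Rightarrow> nat \<Rightarrow> nat" where
  "islands_f_hat m n = max_islands side_adjacent m n"

text \<open>
  The set of rectangular islands is finite and the numbers of islands are bounded, so
  \<^const>\<open>card\<close> and \<^const>\<open>Max\<close> have their intended meaning.
\<close>

lemma finite_islands: "finite {R. rectangular_island adj m n h R}"
  by (rule finite_subset[of _ "Pow (board m n)"])
     (auto simp: rectangular_island_def subrectangle_def board_def)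

lemma finite_num_islands: "finite {num_islands adj m n h | h. True}"
proof (rule finite_subset)
  have "{R. rectangular_island adj m n h R} \<subseteq> Pow (board m n)" for h
    by (auto simp: rectangular_island_def subrectangle_def board_def)
  then have "num_islands adj m n h \<le> card (Pow (board m n))" for h
    unfolding num_islands_def by (intro card_mono) (auto simp: board_def)
  then show "{num_islands adj m n h | h. True} \<subseteq> {..card (Pow (board m n))}"
    by auto
qed simp

lemma point_adjacent_iff:
  "point_adjacent (i, j) (k, l) \<longleftrightarrow>
    (i, j) \<noteq> (k, l) \<and> i \<le> k + 1 \<and> k \<le> i + 1 \<and> j \<le> l + 1 \<and> l \<le> j + 1"
  unfolding point_adjacent_def square_def
  by (auto simp: Times_Int_Times)

lemma side_adjacent_iff:
  "side_adjacent (i, j) (k, l) \<longleftrightarrow>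
    i = k \<and> (j = l + 1 \<or> l = j + 1) \<or> j = l \<and> (i = k + 1 \<or> k = i + 1)"
proof -
  have interval_neq: "{x..x + 1} \<noteq> {y}" "{y} \<noteq> {x..x + 1}" for x y :: real
    by (simp_all add: atLeastAtMost_singleton_iff eq_commute[of "{y}"])
  show ?thesis
    unfolding side_adjacent_def sides_def
    by (auto simp: times_eq_iff interval_neq)
qed

end

theory Submission
  imports Defs
begin

text \<open>
  Sharing a side implies sharing a point, so every island for the point relation is also an island
  for the side relation, which gives one inequality. For the other one both maxima are compared
  with \<open>V = (m + 1)(n + 1)\<close>, the number of grid points of the board: a height function has
  at most \<open>V/2 - 1\<close> islands for the side relation (\<open>num_side_islands_le\<close>), and some
  height function has at least \<open>\<lfloor>V/2\<rfloor> - 1\<close> islands for the point relation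
  (\<open>large_spaced_family_exists\<close>, \<open>spaced_family_point_islands\<close>).

  Upper bound. Two islands for the side relation are nested or do not share any part of a side, so
  the islands form a tree under inclusion. By induction over this tree it suffices to treat the
  maximal islands \<open>S\<close> strictly inside an island \<open>R\<close>: if each \<open>S\<close> has at most
  \<open>|V(S)|/2 - 1\<close> islands below it, itself included, the same bound for \<open>R\<close> requires
  \<open>\<Sum>(2|V(S)| - 4) \<le> 2|V(R)| - 8\<close> (\<open>sum_vertices_detached_le\<close>). Here boxes that touch in
  a corner share a grid point, so the sets \<open>V(S)\<close> are not disjoint. Giving
  the four corners of \<open>S\<close> weight 1 and the other points of \<open>V(S)\<close> weight 2 makes the
  total weight of \<open>S\<close> exactly \<open>2|V(S)| - 4\<close>, while every grid point still
  receives total weight at most 2, because a shared point is a corner of exactly two boxes.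

  The missing 8 comes from the border. The weight on the line of grid points along a border row
  of \<open>R\<close> is twice the number of covered cells in that row. The line has one grid point more than
  the row has cells, so if the row has an uncovered cell, its line stays 4 below the maximum of 2 per
  point. Two opposite border rows, or two opposite border columns, with uncovered cells
  therefore suffice. They exist: a fully covered border row or column lies in a single box, a
  border row and a border column share a cell, so they would lie in the same box, and a box
  containing both is \<open>R\<close> itself.

  Lower bound. A family of pairwise nested or separated boxes is realised by the height function
  that counts the boxes containing a cell. A box of height at least 3 is split into its first
  row, an unused row and the rest, whose grid points partition those of the box; columns are treated
  likewise, and boxes of size at most 2 by 2 are immediate.
\<close>

section \<open>Boxes\<close>

text \<open>
  Quantifiers over boxes are to stay quantifiers over single variables: splitting them into
  four coordinates hides the facts about boxes from the automation.
\<close>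

declare split_paired_All [simp del] split_paired_Ex [simp del]

text \<open>
  A box \<open>(a, b, c, d)\<close> is a rectangle of cells given by half-open row and column intervals, so that
  the grid points on it are given by the closed intervals with the same bounds.
\<close>

type_synonym box = "nat \<times> nat \<times> nat \<times> nat"

fun proper :: "box \<Rightarrow> bool" where
  "proper (a, b, c, d) \<longleftrightarrow> a < b \<and> c < d"

fun cells :: "box \<Rightarrow> cell set" where
  "cells (a, b, c, d) = {a..<b} \<times> {c..<d}"

fun vertices :: "box \<Rightarrow> (nat \<times> nat) set" where
  "vertices (a, b, c, d) = {a..b} \<times> {c..d}"

fun corners :: "box \<Rightarrow> (nat \<times> nat) set" where
  "corners (a, b, c, d) = {a, b} \<times> {c, d}"

text \<open>
  Disjoint grid point sets: no cell of one box shares even a point with a cell of the other.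
\<close>

fun separated :: "box \<Rightarrow> box \<Rightarrow> bool" where
  "separated (a, b, c, d) (a', b', c', d') \<longleftrightarrow> b < a' \<or> b' < a \<or> d < c' \<or> d' < c"

text \<open>
  For proper boxes this says that exactly one grid point is shared, a corner of both.
\<close>

fun corner_touching :: "box \<Rightarrow> box \<Rightarrow> bool" where
  "corner_touching (a, b, c, d) (a', b', c', d') \<longleftrightarrow> (b = a' \<or> b' = a) \<and> (d = c' \<or> d' = c)"

text \<open>
  The relation between disjoint islands when only cells with a common side are neighbors.
\<close>

definition detached :: "box \<Rightarrow> box \<Rightarrow> bool" where
  "detached S T \<longleftrightarrow> separated S T \<or> corner_touching S T"

text \<open>
  Exchanging rows and columns turns statements about border rows into statements about border columns.
\<close>

fun flip :: "box \<Rightarrow> box" where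
  "flip (a, b, c, d) = (c, d, a, b)"

lemma cells_subset_iff:
  assumes "proper (a, b, c, d)"
  shows "cells (a, b, c, d) \<subseteq> cells (a', b', c', d') \<longleftrightarrow> a' \<le> a \<and> b \<le> b' \<and> c' \<le> c \<and> d \<le> d'"
proof
  assume "cells (a, b, c, d) \<subseteq> cells (a', b', c', d')"
  moreover have "(a, c) \<in> cells (a, b, c, d)" "(b - 1, d - 1) \<in> cells (a, b, c, d)"
    using assms by auto
  ultimately have "(a, c) \<in> cells (a', b', c', d')" "(b - 1, d - 1) \<in> cells (a', b', c', d')"
    by blast+
  then show "a' \<le> a \<and> b \<le> b' \<and> c' \<le> c \<and> d \<le> d'" by auto
qed auto

lemma inj_on_cells: "inj_on cells {S. proper S}"
proof (rule inj_onI)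
  fix S T assume ST: "S \<in> {S. proper S}" "T \<in> {S. proper S}" "cells S = cells T"
  obtain a b c d where S: "S = (a, b, c, d)" by (metis prod_cases4)
  obtain a' b' c' d' where T: "T = (a', b', c', d')" by (metis prod_cases4)
  have "cells S \<subseteq> cells T" "cells T \<subseteq> cells S" using ST by auto
  then show "S = T"
    using ST(1,2) cells_subset_iff[of a b c d a' b' c' d'] cells_subset_iff[of a' b' c' d' a b c d]
    unfolding S T by auto
qed

lemma vertices_mono: "proper S \<Longrightarrow> cells S \<subseteq> cells T \<Longrightarrow> vertices S \<subseteq> vertices T"
  by (cases S; cases T) (use cells_subset_iff in auto)

lemma finite_vertices: "finite (vertices S)"
  by (cases S) auto

lemma separated_commute: "separated S T \<longleftrightarrow> separated T S"
  by (cases S; cases T) auto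

lemma detached_commute: "detached S T \<longleftrightarrow> detached T S"
  by (cases S; cases T) (auto simp: detached_def)

lemma detached_cells_disjoint: "detached S T \<Longrightarrow> cells S \<inter> cells T = {}"
  by (cases S; cases T) (auto simp: detached_def)

lemma detached_not_side_adjacent:
  assumes "detached S T" "x \<in> cells S" "y \<in> cells T"
  shows "\<not> side_adjacent x y"
  using assms
  by (cases S; cases T; cases x; cases y) (auto simp: detached_def side_adjacent_iff)

lemma flip_flip [simp]: "flip (flip S) = S"
  by (cases S) auto

lemma inj_flip: "inj flip"
  by (metis flip_flip injI)

lemma proper_flip [simp]: "proper (flip S) \<longleftrightarrow> proper S"
  by (cases S) auto

lemma detached_flip [simp]: "detached (flip S) (flip T) \<longleftrightarrow> detached S T"
  by (cases S; cases T) (auto simp: detached_def)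

lemma in_cells_flip [simp]: "(i, j) \<in> cells (flip S) \<longleftrightarrow> (j, i) \<in> cells S"
  by (cases S) auto

lemma cells_flip_subset [simp]: "cells (flip S) \<subseteq> cells (flip T) \<longleftrightarrow> cells S \<subseteq> cells T"
  by (cases S; cases T) auto

lemma card_vertices_flip [simp]: "card (vertices (flip S)) = card (vertices S)"
  by (cases S) (auto simp: card_cartesian_product)

section \<open>Grid points of detached boxes inside a box\<close>

definition weight :: "box \<Rightarrow> nat \<times> nat \<Rightarrow> nat" where
  "weight S v = (if v \<in> corners S then 1 else if v \<in> vertices S then 2 else 0)"

text \<open>
  A proper box has four different corners, each of which loses one unit against weight 2 on every
  grid point.
\<close>

lemma sum_weight:
  assumes "proper S" "vertices S \<subseteq> W" "finite W"
  shows "(\<Sum>v\<in>W. weight S v) + 4 = 2 * card (vertices S)"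
proof -
  have sub: "corners S \<subseteq> vertices S" and c4: "card (corners S) = 4"
    using assms(1) by (cases S; auto simp: card_cartesian_product)+
  have "(\<Sum>v\<in>W. weight S v) = (\<Sum>v\<in>vertices S. weight S v)"
    using assms sub by (intro sum.mono_neutral_right) (auto simp: weight_def)
  moreover have "(\<Sum>v\<in>vertices S. weight S v) + (\<Sum>v\<in>vertices S. of_bool (v \<in> corners S))
      = (\<Sum>v\<in>vertices S. 2)"
    unfolding sum.distrib[symmetric] by (rule sum.cong) (auto simp: weight_def)
  moreover have "(\<Sum>v\<in>vertices S. of_bool (v \<in> corners S)) = card (corners S)"
    using sub finite_vertices[of S] by (simp add: Int_absorb1)
  ultimately show ?thesis using c4 by simp
qed

lemma detached_share_only_corners:
  assumes "detached S T" "v \<in> vertices S" "v \<in> vertices T" "proper S" "proper T"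
  shows "v \<in> corners S"
  using assms by (cases S; cases T; cases v) (auto simp: detached_def)

text \<open>
  Two detached boxes meet at a common grid point from opposite sides: one begins in the row of
  that point and the other ends there. With only two sides available, no three pairwise detached
  boxes have a common grid point.
\<close>

lemma detached_share_opposite_rows:
  assumes "detached S T" "v \<in> vertices S" "v \<in> vertices T" "proper S" "proper T"
  shows "fst S = fst v \<longleftrightarrow> fst T \<noteq> fst v"
proof -
  obtain a b c d where S: "S = (a, b, c, d)" by (metis prod_cases4)
  obtain a' b' c' d' where T: "T = (a', b', c', d')" by (metis prod_cases4)
  obtain i j where v: "v = (i, j)" by (cases v)
  have "a \<le> i" "i \<le> b" "a' \<le> i" "i \<le> b'" "c \<le> j" "j \<le> d" "c' \<le> j" "j \<le> d'"
    using assms(2,3) by (auto simp: S T v)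
  moreover from this have "b = a' \<or> b' = a" using assms(1) by (auto simp: detached_def S T)
  moreover have "a < b" "a' < b'" using assms(4,5) by (auto simp: S T)
  ultimately show ?thesis unfolding S T v fst_conv by linarith
qed

lemma no_three_detached_at_vertex:
  assumes "detached S T" "detached S U" "detached T U" "proper S" "proper T" "proper U"
    and "v \<in> vertices S" "v \<in> vertices T" "v \<in> vertices U"
  shows False
  using detached_share_opposite_rows[of S T v] detached_share_opposite_rows[of S U v]
    detached_share_opposite_rows[of T U v] assms by argo

text \<open>
  Either \<open>v\<close> lies on some box without being one of its corners, and then on no other box of \<open>M\<close>,
  or \<open>v\<close> is a corner, of weight 1, of each of the at most two boxes of \<open>M\<close> that contain it.
\<close>

lemma sum_weight_at_vertex_le:
  assumes "finite M" "\<And>S. S \<in> M \<Longrightarrow> proper S" "pairwise detached M"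
  shows "(\<Sum>S\<in>M. weight S v) \<le> 2"
proof -
  define N where "N = {S \<in> M. v \<in> vertices S}"
  have N: "N \<subseteq> M" "finite N" using assms(1) by (auto simp: N_def)
  have cv: "corners S \<subseteq> vertices S" if "S \<in> M" for S
    using assms(2)[OF that] by (cases S) auto
  have eq: "(\<Sum>S\<in>M. weight S v) = (\<Sum>S\<in>N. weight S v)"
    using assms(1) N cv by (intro sum.mono_neutral_right) (auto simp: N_def weight_def)
  show ?thesis
  proof (cases "\<exists>S\<in>N. v \<notin> corners S")
    case True
    then obtain S where S: "S \<in> N" "v \<notin> corners S" by blast
    have "T = S" if "T \<in> N" for T
    proof (rule ccontr)
      assume "T \<noteq> S"
      then have "detached S T"
        using pairwiseD[OF assms(3)] S that N by blast
      then show False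
        using detached_share_only_corners[of S T v] S that assms(2) N_def by blast
    qed
    then have "N = {S}" using S by blast
    then show ?thesis unfolding eq by (simp add: weight_def)
  next
    case False
    have "card N \<le> 2"
    proof (rule ccontr)
      assume "\<not> card N \<le> 2"
      then obtain X where X: "X \<subseteq> N" "card X = 3"
        using obtain_subset_with_card_n[of 3 N] by (metis not_less_eq_eq numeral_2_eq_2 numeral_3_eq_3)
      then obtain S T U where STU: "X = {S, T, U}" "S \<noteq> T" "S \<noteq> U" "T \<noteq> U"
        unfolding card_3_iff by metis
      have "S \<in> N" "T \<in> N" "U \<in> N" using STU(1) X(1) by auto
      moreover from this have "detached S T" "detached S U" "detached T U"
        using STU(2-4) N(1) by (auto intro!: pairwiseD[OF assms(3)])
      ultimately show False
        using no_three_detached_at_vertex[of S T U v] assms(2) unfolding N_def by blast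
    qed
    moreover have "(\<Sum>S\<in>N. weight S v) = (\<Sum>S\<in>N. 1)"
      using False by (intro sum.cong) (auto simp: weight_def)
    ultimately show ?thesis unfolding eq by simp
  qed
qed

text \<open>
  Here \<open>y\<close> is the first or the last row of the box \<open>(a, b, c, d)\<close>, and \<open>x\<close> is the line of grid points
  on its outer side. A box occupying \<open>k > 0\<close> cells of the row has \<open>k + 1\<close> points on the line, two of
  which are corners, so its weight there is \<open>2(k + 1) - 2\<close>. A box that misses the row also misses
  the line.
\<close>

lemma sum_weight_border_row:
  assumes "proper S" "cells S \<subseteq> cells (a, b, c, d)"
    and xy: "x = a \<and> y = a \<or> x = b \<and> Suc y = b"
  shows "(\<Sum>j\<in>{c..d}. weight S (x, j)) = 2 * card {j. (y, j) \<in> cells S}"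
proof -
  obtain p q r s where S: "S = (p, q, r, s)" by (metis prod_cases4)
  have b: "p < q" "r < s" "a \<le> p" "q \<le> b" "c \<le> r" "s \<le> d"
    using assms(1,2) cells_subset_iff[of p q r s a b c d] unfolding S by auto
  show ?thesis
  proof (cases "p \<le> y \<and> y < q")
    case True
    \<comment> \<open>A box cannot stick out of the border, so it begins or ends exactly on the line.\<close>
    then have x: "x = p \<or> x = q" using xy b by auto
    have "(\<Sum>j\<in>{c..d}. weight S (x, j)) = (\<Sum>j\<in>{r..s}. weight S (x, j))"
      using b by (intro sum.mono_neutral_right) (auto simp: weight_def S)
    moreover have "{r..s} = insert r (insert s {r<..<s})" using b by auto
    moreover have "(\<Sum>j\<in>{r<..<s}. weight S (x, j)) = (\<Sum>j\<in>{r<..<s}. 2)"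
      using x b by (intro sum.cong) (auto simp: weight_def S)
    moreover have "weight S (x, r) = 1" "weight S (x, s) = 1"
      using x by (auto simp: weight_def S)
    moreover have "{j. (y, j) \<in> cells S} = {r..<s}" using True by (auto simp: S)
    ultimately show ?thesis using b by auto
  next
    case False
    then have "x \<notin> {p..q}" using xy b by auto
    then have "weight S (x, j) = 0" for j using b by (auto simp: weight_def S)
    moreover have "{j. (y, j) \<in> cells S} = {}" using False by (auto simp: S)
    ultimately show ?thesis by simp
  qed
qed

text \<open>
  Disjoint boxes cover at most \<open>d - c - 1\<close> cells of a row with an uncovered cell, so their weight
  on the border line is at most \<open>2(d - c - 1)\<close>, which is 4 less than twice its \<open>d - c + 1\<close> points.
\<close>

lemma border_row_deficit:
  assumes "finite M" "\<And>S. S \<in> M \<Longrightarrow> proper S" "pairwise detached M"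
    and sub: "\<And>S. S \<in> M \<Longrightarrow> cells S \<subseteq> cells (a, b, c, d)"
    and xy: "x = a \<and> y = a \<or> x = b \<and> Suc y = b"
    and unc: "k \<in> {c..<d}" "\<And>S. S \<in> M \<Longrightarrow> (y, k) \<notin> cells S"
  shows "(\<Sum>j\<in>{c..d}. \<Sum>S\<in>M. weight S (x, j)) + 4 \<le> 2 * card {c..d}"
proof -
  let ?row = "\<lambda>S. {j. (y, j) \<in> cells S}"
  have row: "?row S \<subseteq> {c..<d} - {k}" if "S \<in> M" for S
  proof
    fix j assume "j \<in> ?row S"
    then have "(y, j) \<in> cells S" by simp
    moreover from this have "(y, j) \<in> cells (a, b, c, d)" using sub[OF that] by blast
    ultimately show "j \<in> {c..<d} - {k}" using unc(2)[OF that] by auto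
  qed
  have "(\<Sum>j\<in>{c..d}. \<Sum>S\<in>M. weight S (x, j)) = (\<Sum>S\<in>M. \<Sum>j\<in>{c..d}. weight S (x, j))"
    by (rule sum.swap)
  also have "\<dots> = (\<Sum>S\<in>M. 2 * card (?row S))"
    using assms(2) sub xy by (intro sum.cong refl sum_weight_border_row) auto
  also have "\<dots> = 2 * (\<Sum>S\<in>M. card (?row S))"
    by (simp add: sum_distrib_left)
  also have "(\<Sum>S\<in>M. card (?row S)) = card (\<Union>S\<in>M. ?row S)"
  proof (rule card_UN_disjoint[symmetric])
    show "\<forall>S\<in>M. finite (?row S)"
      using row finite_subset[of _ "{c..<d} - {k}"] by blast
    show "\<forall>S\<in>M. \<forall>T\<in>M. S \<noteq> T \<longrightarrow> ?row S \<inter> ?row T = {}"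
      using detached_cells_disjoint pairwiseD[OF assms(3)] by blast
  qed (rule assms(1))
  also have "\<dots> \<le> card ({c..<d} - {k})"
    by (rule card_mono) (use row in blast)+
  also have "\<dots> = d - c - 1" using unc(1) by simp
  finally show ?thesis using unc(1) by auto
qed

text \<open>
  The weights are summed over all grid points of \<open>(a, b, c, d)\<close>, line by line. Every line has average
  weight at most 2, and the first and last lines each fall short by 4.
\<close>

lemma sum_vertices_detached_le_if_rows_uncovered:
  assumes "finite M" "\<And>S. S \<in> M \<Longrightarrow> proper S" "pairwise detached M"
    and sub: "\<And>S. S \<in> M \<Longrightarrow> cells S \<subseteq> cells (a, b, c, d)"
    and ab: "a < b"
    and top: "k \<in> {c..<d}" "\<And>S. S \<in> M \<Longrightarrow> (a, k) \<notin> cells S"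
    and bot: "l \<in> {c..<d}" "\<And>S. S \<in> M \<Longrightarrow> (b - 1, l) \<notin> cells S"
  shows "(\<Sum>S\<in>M. 2 * card (vertices S)) + 8 \<le> 4 * card M + 2 * card (vertices (a, b, c, d))"
proof -
  let ?R = "(a, b, c, d)" and ?g = "\<lambda>i j. \<Sum>S\<in>M. weight S (i, j)"
  have "(\<Sum>S\<in>M. 2 * card (vertices S)) = (\<Sum>S\<in>M. (\<Sum>v\<in>vertices ?R. weight S v) + 4)"
    using assms(2) sub finite_vertices vertices_mono
    by (intro sum.cong refl sum_weight[symmetric]) blast+
  also have "\<dots> = (\<Sum>S\<in>M. \<Sum>v\<in>vertices ?R. weight S v) + 4 * card M"
    by (simp add: sum.distrib)
  also have "(\<Sum>S\<in>M. \<Sum>v\<in>vertices ?R. weight S v) = (\<Sum>v\<in>vertices ?R. \<Sum>S\<in>M. weight S v)"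
    by (rule sum.swap)
  also have "\<dots> = (\<Sum>i\<in>{a..b}. \<Sum>j\<in>{c..d}. ?g i j)"
    unfolding vertices.simps sum.cartesian_product
    by (simp add: sum.cartesian_product' split_def)
  also have "{a..b} = insert a (insert b {a<..<b})" using ab by auto
  finally have eq: "(\<Sum>S\<in>M. 2 * card (vertices S)) =
      (\<Sum>j\<in>{c..d}. ?g a j) + (\<Sum>j\<in>{c..d}. ?g b j) +
      (\<Sum>i\<in>{a<..<b}. \<Sum>j\<in>{c..d}. ?g i j) + 4 * card M"
    using ab by auto
  have "(\<Sum>j\<in>{c..d}. ?g a j) + 4 \<le> 2 * card {c..d}"
    by (rule border_row_deficit[OF assms(1-3) sub _ top]) simp_all
  moreover have "(\<Sum>j\<in>{c..d}. ?g b j) + 4 \<le> 2 * card {c..d}"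
    by (rule border_row_deficit[OF assms(1-3) sub _ bot]) (use ab in simp_all)
  moreover have "(\<Sum>i\<in>{a<..<b}. \<Sum>j\<in>{c..d}. ?g i j) \<le> (\<Sum>i\<in>{a<..<b}. \<Sum>j\<in>{c..d}. 2)"
    by (intro sum_mono sum_weight_at_vertex_le assms(1-3))
  moreover have "card (vertices ?R) = card {a<..<b} * card {c..d} + 2 * card {c..d}"
  proof -
    have "Suc b - a = (b - Suc a) + 2" using ab by simp
    then show ?thesis
      by (simp add: card_cartesian_product add_mult_distrib)
  qed
  ultimately show ?thesis using eq by simp
qed

lemma sum_vertices_detached_le_if_columns_uncovered:
  assumes "finite M" "\<And>S. S \<in> M \<Longrightarrow> proper S" "pairwise detached M"
    and sub: "\<And>S. S \<in> M \<Longrightarrow> cells S \<subseteq> cells (a, b, c, d)"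
    and cd: "c < d"
    and left: "k \<in> {a..<b}" "\<And>S. S \<in> M \<Longrightarrow> (k, c) \<notin> cells S"
    and right: "l \<in> {a..<b}" "\<And>S. S \<in> M \<Longrightarrow> (l, d - 1) \<notin> cells S"
  shows "(\<Sum>S\<in>M. 2 * card (vertices S)) + 8 \<le> 4 * card M + 2 * card (vertices (a, b, c, d))"
proof -
  have inj: "inj_on flip M" by (rule inj_on_subset[OF inj_flip]) simp
  have "(\<Sum>S\<in>flip ` M. 2 * card (vertices S)) + 8
      \<le> 4 * card (flip ` M) + 2 * card (vertices (c, d, a, b))"
  proof (rule sum_vertices_detached_le_if_rows_uncovered)
    show "pairwise detached (flip ` M)"
      using assms(3) by (auto simp: pairwise_def)
    show "cells S \<subseteq> cells (c, d, a, b)" if "S \<in> flip ` M" for S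
    proof -
      obtain T where "T \<in> M" "S = flip T" using \<open>S \<in> flip ` M\<close> by blast
      then show ?thesis using sub[of T] cells_flip_subset[of T "(a, b, c, d)"] by (metis flip.simps)
    qed
    show "proper S" if "S \<in> flip ` M" for S using that assms(2) by fastforce
    show "(c, k) \<notin> cells S" "(d - 1, l) \<notin> cells S" if "S \<in> flip ` M" for S
      using that left(2) right(2) by (metis imageE in_cells_flip)+
  qed (use assms(1) cd left(1) right(1) in auto)
  then show ?thesis
    by (simp add: sum.reindex[OF inj] card_image[OF inj] card_cartesian_product mult.commute)
qed

text \<open>
  Two side-adjacent cells cannot lie in different detached boxes, so the covering box never changes along a
  path of side-adjacent cells.
\<close>

lemma one_box_covers_path:
  assumes "pairwise detached M"
    and path: "\<And>j. side_adjacent (f j) (f (Suc j))"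
    and cov: "\<And>j. j \<in> {c..<d} \<Longrightarrow> \<exists>S\<in>M. f j \<in> cells S"
    and cd: "c < d"
  shows "\<exists>S\<in>M. \<forall>j\<in>{c..<d}. f j \<in> cells S"
proof -
  obtain S where S: "S \<in> M" "f c \<in> cells S" using cov[of c] cd by auto
  have "j < d \<longrightarrow> f j \<in> cells S" if "c \<le> j" for j
    using that
  proof (induction j rule: dec_induct)
    case base
    show ?case using S by simp
  next
    case (step j)
    show ?case
    proof
      assume j: "Suc j < d"
      then obtain T where T: "T \<in> M" "f (Suc j) \<in> cells T" using cov[of "Suc j"] step by auto
      have "\<not> detached S T"
        using detached_not_side_adjacent[of S T "f j" "f (Suc j)"] path[of j] step j T by auto
      then have "S = T" using pairwiseD[OF assms(1)] S T by blast
      then show "f (Suc j) \<in> cells S" using T by simp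
    qed
  qed
  then have "\<forall>j\<in>{c..<d}. f j \<in> cells S" by auto
  then show ?thesis using S by blast
qed

text \<open>
  If a border row and a border column were both fully covered, each would lie in a single box, and the
  two boxes would coincide because they share a corner cell of \<open>R\<close>. That box would contain two
  opposite corner cells of \<open>R\<close>, hence all of \<open>R\<close>. So both border rows or both border columns have
  uncovered cells.
\<close>

lemma sum_vertices_detached_le:
  assumes "finite M" "\<And>S. S \<in> M \<Longrightarrow> proper S" "pairwise detached M"
    and sub: "\<And>S. S \<in> M \<Longrightarrow> cells S \<subset> cells R"
    and "proper R"
  shows "(\<Sum>S\<in>M. 2 * card (vertices S)) + 8 \<le> 4 * card M + 2 * card (vertices R)"
proof -
  obtain a b c d where R: "R = (a, b, c, d)" by (metis prod_cases4)
  have ab: "a < b" and cd: "c < d" using \<open>proper R\<close> by (auto simp: R)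
  have subR: "cells S \<subseteq> cells (a, b, c, d)" if "S \<in> M" for S
    using sub[OF that] unfolding R by blast
  have opposite: False
    if "S \<in> M" "(a, c) \<in> cells S \<and> (b - 1, d - 1) \<in> cells S \<or>
      (a, d - 1) \<in> cells S \<and> (b - 1, c) \<in> cells S" for S
  proof -
    have "cells R \<subseteq> cells S"
      using that(2) by (cases S) (auto simp: R)
    then show False using sub[OF that(1)] by blast
  qed
  define full_row where "full_row x \<longleftrightarrow> (\<forall>j\<in>{c..<d}. \<exists>S\<in>M. (x, j) \<in> cells S)" for x
  define full_col where "full_col y \<longleftrightarrow> (\<forall>i\<in>{a..<b}. \<exists>S\<in>M. (i, y) \<in> cells S)" for y
  have no_cross: False
    if "full_row x" "full_col y" "x = a \<or> x = b - 1" "y = c \<or> y = d - 1" for x y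
  proof -
    have "\<exists>S\<in>M. \<forall>j\<in>{c..<d}. (x, j) \<in> cells S"
      by (rule one_box_covers_path[OF assms(3) _ _ cd])
        (use that(1) in \<open>auto simp: full_row_def side_adjacent_iff\<close>)
    then obtain S where S: "S \<in> M" "\<forall>j\<in>{c..<d}. (x, j) \<in> cells S" by blast
    have "\<exists>T\<in>M. \<forall>i\<in>{a..<b}. (i, y) \<in> cells T"
      by (rule one_box_covers_path[OF assms(3) _ _ ab])
        (use that(2) in \<open>auto simp: full_col_def side_adjacent_iff\<close>)
    then obtain T where T: "T \<in> M" "\<forall>i\<in>{a..<b}. (i, y) \<in> cells T" by blast
    have "(x, y) \<in> cells S \<inter> cells T" using S T that(3,4) ab cd by auto
    then have "S = T"
      using detached_cells_disjoint[of S T] pairwiseD[OF assms(3)] S T by blast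
    moreover have "(x, c) \<in> cells S" "(x, d - 1) \<in> cells S" "(a, y) \<in> cells T" "(b - 1, y) \<in> cells T"
      using S T ab cd by auto
    ultimately show False using opposite[OF S(1)] that(3,4) by blast
  qed
  show ?thesis
  proof (cases "full_row a \<or> full_row (b - 1)")
    case False
    then obtain k l where "k \<in> {c..<d}" "\<forall>S\<in>M. (a, k) \<notin> cells S"
      "l \<in> {c..<d}" "\<forall>S\<in>M. (b - 1, l) \<notin> cells S"
      unfolding full_row_def by blast
    then show ?thesis
      unfolding R using assms(1-3) subR ab
      by (intro sum_vertices_detached_le_if_rows_uncovered[OF assms(1-3) subR]) blast+
  next
    case True
    then have "\<not> full_col c" "\<not> full_col (d - 1)" using no_cross by blast+
    then obtain k l where "k \<in> {a..<b}" "\<forall>S\<in>M. (k, c) \<notin> cells S"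
      "l \<in> {a..<b}" "\<forall>S\<in>M. (l, d - 1) \<notin> cells S"
      unfolding full_col_def by blast
    then show ?thesis
      unfolding R using assms(1-3) subR cd
      by (intro sum_vertices_detached_le_if_columns_uncovered[OF assms(1-3) subR]) blast+
  qed
qed

section \<open>At most \<open>V/2 - 1\<close> islands for the side relation\<close>

definition nested :: "box \<Rightarrow> box \<Rightarrow> bool" where
  "nested S T \<longleftrightarrow> cells S \<subseteq> cells T \<or> cells T \<subseteq> cells S"

text \<open>
  Induction over the inclusion tree: the family consists of \<open>R\<close> and the subfamilies below
  the maximal members \<open>M\<close> strictly inside \<open>R\<close>, which are pairwise detached. The bound
  passes from these to \<open>R\<close> by \<open>sum_vertices_detached_le\<close>.
\<close>

lemma card_laminar_le:
  assumes "finite F" "\<And>S. S \<in> F \<Longrightarrow> proper S" "pairwise (\<lambda>S T. nested S T \<or> detached S T) F"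
    and "R \<in> F" "\<And>S. S \<in> F \<Longrightarrow> cells S \<subseteq> cells R"
  shows "2 * card F + 2 \<le> card (vertices R)"
  using assms
proof (induction "card F" arbitrary: F R rule: less_induct)
  case less
  let ?G = "F - {R}"
  define M where "M = {S \<in> ?G. \<forall>T\<in>?G. cells S \<subseteq> cells T \<longrightarrow> T = S}"
  define below where "below S = {T \<in> F. cells T \<subseteq> cells S}" for S
  have inj: "S = T" if "S \<in> F" "T \<in> F" "cells S = cells T" for S T
    using inj_onD[OF inj_on_cells] that less.prems(2) by blast
  have M: "finite M" "M \<subseteq> F" "R \<notin> M" using less.prems(1) by (auto simp: M_def)
  have sub: "cells S \<subset> cells R" if "S \<in> M" for S
    using less.prems(4,5) inj[of S R] that M by blast
  have "pairwise detached M"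
  proof (rule pairwiseI)
    fix S T assume "S \<in> M" "T \<in> M" "S \<noteq> T"
    then show "detached S T"
      using pairwiseD[OF less.prems(3), of S T] by (auto simp: M_def nested_def)
  qed
  then have wb: "(\<Sum>S\<in>M. 2 * card (vertices S)) + 8 \<le> 4 * card M + 2 * card (vertices R)"
    using M sub less.prems(2,4) by (intro sum_vertices_detached_le) auto
  have ih: "2 * card (below S) + 2 \<le> card (vertices S)" if "S \<in> M" for S
  proof (rule less.hyps)
    have "below S \<subset> F"
      using sub[OF that] less.prems(4) by (auto simp: below_def)
    then show "card (below S) < card F"
      using less.prems(1) by (rule psubset_card_mono[rotated])
    show "pairwise (\<lambda>S T. nested S T \<or> detached S T) (below S)"
      by (rule pairwise_subset[OF less.prems(3)]) (auto simp: below_def)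
  qed (use less.prems(1,2) that M in \<open>auto simp: below_def\<close>)
  have "?G \<subseteq> (\<Union>S\<in>M. below S)"
  proof
    fix T assume T: "T \<in> ?G"
    have "finite (cells ` ?G)" using less.prems(1) by simp
    then obtain C where C: "C \<in> cells ` ?G" "cells T \<subseteq> C"
      "\<forall>D\<in>cells ` ?G. C \<subseteq> D \<longrightarrow> C = D"
      using finite_has_maximal2[of "cells ` ?G" "cells T"] T by blast
    then obtain S where S: "S \<in> ?G" "C = cells S" by blast
    have "U = S" if U: "U \<in> ?G" "cells S \<subseteq> cells U" for U
    proof -
      have "cells U = cells S" using C(3) U S(2) by blast
      then show ?thesis using inj[of U S] U(1) S(1) by blast
    qed
    then have "S \<in> M" unfolding M_def using S(1) by simp
    then show "T \<in> (\<Union>S\<in>M. below S)" using C S T by (auto simp: below_def)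
  qed
  moreover have "finite (\<Union>S\<in>M. below S)"
    using M less.prems(1) by (auto simp: below_def)
  ultimately have "card ?G \<le> card (\<Union>S\<in>M. below S)" by (rule card_mono[rotated])
  also have "\<dots> \<le> (\<Sum>S\<in>M. card (below S))" using M by (intro card_UN_le)
  finally have "card F \<le> 1 + (\<Sum>S\<in>M. card (below S))" using less.prems(1,4) by simp
  moreover have "(\<Sum>S\<in>M. 4 * card (below S) + 4) \<le> (\<Sum>S\<in>M. 2 * card (vertices S))"
    by (rule sum_mono) (use ih in fastforce)
  then have "4 * (\<Sum>S\<in>M. card (below S)) + 4 * card M \<le> (\<Sum>S\<in>M. 2 * card (vertices S))"
    by (simp add: sum.distrib sum_distrib_left)
  ultimately show ?case using wb by simp
qed

lemma subrectangle_iff_box: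
  "subrectangle m n R \<longleftrightarrow> (\<exists>S. proper S \<and> cells S \<subseteq> cells (0, m, 0, n) \<and> R = cells S)"
proof
  assume "subrectangle m n R"
  then obtain a b c d where "a \<le> b" "b < m" "c \<le> d" "d < n" "R = {a..b} \<times> {c..d}"
    unfolding subrectangle_def by blast
  then show "\<exists>S. proper S \<and> cells S \<subseteq> cells (0, m, 0, n) \<and> R = cells S"
    by (intro exI[of _ "(a, Suc b, c, Suc d)"]) (auto simp: atLeastLessThanSuc_atLeastAtMost)
next
  assume "\<exists>S. proper S \<and> cells S \<subseteq> cells (0, m, 0, n) \<and> R = cells S"
  then obtain a b c d where "proper (a, b, c, d)" "cells (a, b, c, d) \<subseteq> cells (0, m, 0, n)"
    and R: "R = cells (a, b, c, d)" by (metis prod_cases4)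
  then have "a < b" "c < d" "b \<le> m" "d \<le> n" using cells_subset_iff by auto
  then show "subrectangle m n R"
    unfolding subrectangle_def R
    by (intro exI[of _ a] exI[of _ "b - 1"] exI[of _ c] exI[of _ "d - 1"]) auto
qed

lemma rectangular_island_iff:
  "rectangular_island adj m n h R \<longleftrightarrow>
    subrectangle m n R \<and> (\<forall>x\<in>R. \<forall>y\<in>neighbors adj m n R. h y < h x)"
proof (cases "subrectangle m n R")
  case True
  then have R: "finite R" "R \<noteq> {}" by (auto simp: subrectangle_def)
  have "finite (neighbors adj m n R)"
    by (rule finite_subset[of _ "board m n"]) (auto simp: neighbors_def board_def)
  then show ?thesis
    using True R unfolding rectangular_island_def
    by (cases "neighbors adj m n R = {}") auto
qed (simp add: rectangular_island_def)

text \<open>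
  Boxes that are not detached overlap in their row range or in their column range and at least
  touch in the other. Moving within a common row or column out of \<open>T\<close> towards a part of \<open>S\<close> beyond
  \<open>T\<close> crosses a side between a cell of \<open>T\<close> and a cell of \<open>S\<close> outside \<open>T\<close>.
\<close>

lemma side_adjacent_exit:
  assumes "proper S" "proper T" "\<not> cells S \<subseteq> cells T" "\<not> detached S T"
  shows "\<exists>x\<in>cells S - cells T. \<exists>y\<in>cells T. side_adjacent x y"
proof -
  obtain a b c d where S: "S = (a, b, c, d)" by (metis prod_cases4)
  obtain a' b' c' d' where T: "T = (a', b', c', d')" by (metis prod_cases4)
  have p: "a < b" "c < d" "a' < b'" "c' < d'" using assms(1,2) by (auto simp: S T)
  have touch: "a' \<le> b" "a \<le> b'" "c' \<le> d" "c \<le> d'"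
    and overlap: "a' < b \<and> a < b' \<or> c' < d \<and> c < d'"
    using assms(4) p by (auto simp: S T detached_def)
  have exit: "a < a' \<or> b' < b \<or> c < c' \<or> d' < d"
    using assms(1,3) cells_subset_iff[of a b c d a' b' c' d'] by (auto simp: S T)
  have wit: ?thesis if "(i, j) \<in> cells S - cells T" "(k, l) \<in> cells T" "side_adjacent (i, j) (k, l)"
    for i j k l using that by blast
  \<comment> \<open>If \<open>S\<close> leaves \<open>T\<close> only in a direction whose transversal ranges merely touch, then \<open>S\<close> leaves
    \<open>T\<close> in that transversal direction as well.\<close>
  consider "c' < d \<and> c < d'" "a < a'" | "c' < d \<and> c < d'" "b' < b"
    | "a' < b \<and> a < b'" "c < c'" | "a' < b \<and> a < b'" "d' < d"
    using exit overlap touch p by linarith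
  then show ?thesis
  proof cases
    case 1
    then show ?thesis
      using p touch by (intro wit[of "a' - 1" "max c c'" a' "max c c'"])
        (auto simp: S T side_adjacent_iff)
  next
    case 2
    then show ?thesis
      using p touch by (intro wit[of b' "max c c'" "b' - 1" "max c c'"])
        (auto simp: S T side_adjacent_iff)
  next
    case 3
    then show ?thesis
      using p touch by (intro wit[of "max a a'" "c' - 1" "max a a'" c'])
        (auto simp: S T side_adjacent_iff)
  next
    case 4
    then show ?thesis
      using p touch by (intro wit[of "max a a'" d' "max a a'" "d' - 1"])
        (auto simp: S T side_adjacent_iff)
  qed
qed

text \<open>
  Otherwise \<open>S\<close> has a cell \<open>x\<close> that is a neighbor of \<open>T\<close>, hence lower than all cells of \<open>T\<close>, and \<open>T\<close>
  has a cell \<open>u\<close> that is a neighbor of \<open>S\<close>, hence lower than all cells of \<open>S\<close>; then each of \<open>x\<close> and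
  \<open>u\<close> is lower than the other.
\<close>

lemma side_islands_nested_or_detached:
  assumes "proper S" "proper T"
    and S: "rectangular_island side_adjacent m n h (cells S)"
    and T: "rectangular_island side_adjacent m n h (cells T)"
  shows "nested S T \<or> detached S T"
proof (rule ccontr)
  assume "\<not> ?thesis"
  then have not: "\<not> cells S \<subseteq> cells T" "\<not> cells T \<subseteq> cells S" "\<not> detached S T" "\<not> detached T S"
    by (auto simp: nested_def detached_commute)
  have board: "cells S \<subseteq> board m n" "cells T \<subseteq> board m n"
    using S T unfolding rectangular_island_def subrectangle_def board_def by auto
  obtain x y where x: "x \<in> cells S - cells T" "y \<in> cells T" "side_adjacent x y"
    using side_adjacent_exit[of S T] assms not by blast
  obtain u v where u: "u \<in> cells T - cells S" "v \<in> cells S" "side_adjacent u v"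
    using side_adjacent_exit[of T S] assms not by blast
  have "h x < h u" "h u < h x"
    using S T x u board unfolding rectangular_island_iff neighbors_def by blast+
  then show False by simp
qed

lemma num_side_islands_le:
  assumes "m \<ge> 1" "n \<ge> 1"
  shows "2 * num_islands side_adjacent m n h + 2 \<le> (m + 1) * (n + 1)"
proof -
  let ?R = "(0, m, 0, n)"
  define F where "F = {S. proper S \<and> rectangular_island side_adjacent m n h (cells S)}"
  have inj: "inj_on cells F" by (rule inj_on_subset[OF inj_on_cells]) (auto simp: F_def)
  have img: "cells ` F = {R. rectangular_island side_adjacent m n h R}"
    unfolding F_def rectangular_island_def subrectangle_iff_box by blast
  have "finite F" using finite_imageD[OF _ inj] img finite_islands by metis
  moreover have "?R \<in> F"
  proof -
    have "subrectangle m n (cells ?R)"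
      unfolding subrectangle_iff_box using assms by (intro exI[of _ ?R]) auto
    then show ?thesis
      using assms unfolding F_def rectangular_island_def by (auto simp: neighbors_def board_def)
  qed
  moreover have "pairwise (\<lambda>S T. nested S T \<or> detached S T) F"
    unfolding pairwise_def F_def using side_islands_nested_or_detached by blast
  moreover have "cells S \<subseteq> cells ?R" if "S \<in> F" for S
    using that unfolding F_def rectangular_island_def subrectangle_iff_box by blast
  ultimately have "2 * card F + 2 \<le> card (vertices ?R)"
    by (intro card_laminar_le) (auto simp: F_def)
  moreover have "card F = num_islands side_adjacent m n h"
    unfolding num_islands_def img[symmetric] using card_image[OF inj] by simp
  ultimately show ?thesis by (simp add: card_cartesian_product)
qed

section \<open>Many islands for the point relation\<close>

definition spaced_family :: "box \<Rightarrow> box set \<Rightarrow> bool" where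
  "spaced_family R F \<longleftrightarrow> finite F \<and> (\<forall>S\<in>F. proper S \<and> cells S \<subseteq> cells R) \<and>
    pairwise (\<lambda>S T. nested S T \<or> separated S T) F"

lemma separated_mono:
  assumes "separated R1 R2" "proper S" "proper T" "cells S \<subseteq> cells R1" "cells T \<subseteq> cells R2"
  shows "separated S T"
proof -
  obtain a b c d where S: "S = (a, b, c, d)" by (metis prod_cases4)
  obtain a' b' c' d' where T: "T = (a', b', c', d')" by (metis prod_cases4)
  obtain p q r s where R1: "R1 = (p, q, r, s)" by (metis prod_cases4)
  obtain p' q' r' s' where R2: "R2 = (p', q', r', s')" by (metis prod_cases4)
  have "p \<le> a" "b \<le> q" "r \<le> c" "d \<le> s"
    using assms(2,4) cells_subset_iff[of a b c d p q r s] unfolding S R1 by blast+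
  moreover have "p' \<le> a'" "b' \<le> q'" "r' \<le> c'" "d' \<le> s'"
    using assms(3,5) cells_subset_iff[of a' b' c' d' p' q' r' s'] unfolding T R2 by blast+
  ultimately show ?thesis
    using assms(1) unfolding S T R1 R2 separated.simps by linarith
qed

lemma spaced_family_glue:
  assumes "spaced_family R1 F1" "spaced_family R2 F2" "separated R1 R2" "proper R"
    and sub: "cells R1 \<subset> cells R" "cells R2 \<subset> cells R"
  shows "spaced_family R (insert R (F1 \<union> F2))"
    and "card (insert R (F1 \<union> F2)) = card F1 + card F2 + 1"
proof -
  have fin: "finite F1" "finite F2" using assms(1,2) by (auto simp: spaced_family_def)
  have p: "proper S" "cells S \<subseteq> cells R" "S \<noteq> R" if "S \<in> F1 \<union> F2" for S
    using that assms(1,2) sub unfolding spaced_family_def by blast+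
  have sep: "separated S T" "separated T S" if "S \<in> F1" "T \<in> F2" for S T
    using separated_mono[OF assms(3), of S T] that assms(1,2) separated_commute[of S T]
    unfolding spaced_family_def by blast+
  have "nested S T \<or> separated S T"
    if "S \<in> insert R (F1 \<union> F2)" "T \<in> insert R (F1 \<union> F2)" "S \<noteq> T" for S T
  proof (cases "S = R \<or> T = R")
    case True
    then show ?thesis using p that unfolding nested_def by blast
  next
    case False
    then show ?thesis
      using that sep assms(1,2) unfolding spaced_family_def pairwise_def by blast
  qed
  then show "spaced_family R (insert R (F1 \<union> F2))"
    unfolding spaced_family_def pairwise_def using fin p \<open>proper R\<close> by blast
  have "F1 \<inter> F2 = {}"
  proof -
    have "\<not> separated S S" if "proper S" for S using that by (cases S) auto
    then show ?thesis using sep p by blast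
  qed
  then show "card (insert R (F1 \<union> F2)) = card F1 + card F2 + 1"
    using fin p(3)[of R] by (subst card_insert_disjoint) (auto simp: card_Un_disjoint)
qed

text \<open>
  The goal asks for \<open>card F \<ge> \<lfloor>card (vertices R) / 2\<rfloor> - 1\<close>. If \<open>R1\<close> has an even number of grid
  points, nothing is lost by rounding there, and the additional member \<open>R\<close> makes up for one of the
  two terms \<open>-1\<close> coming from the parts.
\<close>

lemma spaced_family_split:
  assumes F1: "spaced_family R1 F1" "card (vertices R1) \<le> 2 * card F1 + 3"
    and F2: "spaced_family R2 F2" "card (vertices R2) \<le> 2 * card F2 + 3"
    and "separated R1 R2" "proper R" "cells R1 \<subset> cells R" "cells R2 \<subset> cells R"
    and "even (card (vertices R1))"
    and "card (vertices R) = card (vertices R1) + card (vertices R2)"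
  shows "\<exists>F. spaced_family R F \<and> card (vertices R) \<le> 2 * card F + 3"
proof -
  have "card (vertices R1) \<noteq> 2 * card F1 + 3" using assms(9) by auto
  then have "card (vertices R1) \<le> 2 * card F1 + 2" using F1(2) by simp
  then show ?thesis
    using spaced_family_glue[OF F1(1) F2(1) assms(5-8)] F2(2) assms(10)
    by (intro exI[of _ "insert R (F1 \<union> F2)"]) auto
qed

text \<open>
  Cutting off a single row or column produces a part with two lines of equally many grid points,
  an even number as required by the splitting step. Leaving the next row or column empty separates
  the parts, and no grid point is lost, since the line that bounds the empty strip on either side
  belongs to one of the parts. In a box of size at most 2 by 2, the box, its first row and its first
  cell suffice.
\<close>

lemma large_spaced_family_exists:
  "proper R \<Longrightarrow> \<exists>F. spaced_family R F \<and> card (vertices R) \<le> 2 * card F + 3"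
proof (induction "card (vertices R)" arbitrary: R rule: less_induct)
  case less
  obtain a b c d where R: "R = (a, b, c, d)" by (metis prod_cases4)
  have ab: "a < b" and cd: "c < d" using less.prems by (auto simp: R)
  have cardV: "card (vertices (p, q, r, s)) = (Suc q - p) * (Suc s - r)" for p q r s
    by (simp add: card_cartesian_product)
  consider "a + 3 \<le> b" | "c + 3 \<le> d" | "b \<le> a + 2" "d \<le> c + 2" by linarith
  then show ?case
  proof cases
    case 1
    let ?R1 = "(a, Suc a, c, d)" and ?R2 = "(a + 2, b, c, d)"
    have len: "Suc b - a = 2 + (Suc b - (a + 2))" using 1 by simp
    have sum: "card (vertices R) = card (vertices ?R1) + card (vertices ?R2)"
      unfolding R cardV len add_mult_distrib by simp
    have pos: "0 < card (vertices ?R1)" "0 < card (vertices ?R2)"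
      unfolding cardV using 1 cd by auto
    obtain F1 where F1: "spaced_family ?R1 F1" "card (vertices ?R1) \<le> 2 * card F1 + 3"
      using less.hyps[of ?R1] sum pos cd by (metis less_add_same_cancel1 lessI proper.simps)
    obtain F2 where F2: "spaced_family ?R2 F2" "card (vertices ?R2) \<le> 2 * card F2 + 3"
      using less.hyps[of ?R2] sum pos cd 1 by auto
    have sub: "cells ?R1 \<subset> cells R" "cells ?R2 \<subset> cells R"
    proof -
      have "(a, c) \<in> cells R - cells ?R2" "(b - 1, c) \<in> cells R - cells ?R1"
        using 1 cd by (auto simp: R)
      moreover have "cells ?R1 \<subseteq> cells R" "cells ?R2 \<subseteq> cells R"
        using 1 by (auto simp: R)
      ultimately show "cells ?R1 \<subset> cells R" "cells ?R2 \<subset> cells R" by blast+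
    qed
    show ?thesis
      by (rule spaced_family_split[OF F1 F2 _ less.prems sub _ sum]) (simp_all add: cardV)
  next
    case 2
    let ?R1 = "(a, b, c, Suc c)" and ?R2 = "(a, b, c + 2, d)"
    have len: "Suc d - c = 2 + (Suc d - (c + 2))" using 2 by simp
    have sum: "card (vertices R) = card (vertices ?R1) + card (vertices ?R2)"
      unfolding R cardV len add_mult_distrib2 by simp
    have pos: "0 < card (vertices ?R1)" "0 < card (vertices ?R2)"
      unfolding cardV using 2 ab by auto
    obtain F1 where F1: "spaced_family ?R1 F1" "card (vertices ?R1) \<le> 2 * card F1 + 3"
      using less.hyps[of ?R1] sum pos ab by (metis less_add_same_cancel1 lessI proper.simps)
    obtain F2 where F2: "spaced_family ?R2 F2" "card (vertices ?R2) \<le> 2 * card F2 + 3"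
      using less.hyps[of ?R2] sum pos ab 2 by auto
    have sub: "cells ?R1 \<subset> cells R" "cells ?R2 \<subset> cells R"
    proof -
      have "(a, c) \<in> cells R - cells ?R2" "(a, d - 1) \<in> cells R - cells ?R1"
        using 2 ab by (auto simp: R)
      moreover have "cells ?R1 \<subseteq> cells R" "cells ?R2 \<subseteq> cells R"
        using 2 by (auto simp: R)
      ultimately show "cells ?R1 \<subset> cells R" "cells ?R2 \<subset> cells R" by blast+
    qed
    show ?thesis
      by (rule spaced_family_split[OF F1 F2 _ less.prems sub _ sum]) (simp_all add: cardV)
  next
    case 3
    let ?F = "{R, (a, Suc a, c, d), (a, Suc a, c, Suc c)}"
    have "spaced_family R ?F"
      using ab cd by (auto simp: spaced_family_def pairwise_def nested_def R)
    moreover have "card (vertices R) \<le> 2 * card ?F + 3"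
    proof -
      have "b = Suc a \<or> b = Suc (Suc a)" "d = Suc c \<or> d = Suc (Suc c)" using 3 ab cd by auto
      then show ?thesis unfolding R cardV by (auto simp: card_insert_if)
    qed
    ultimately show ?thesis by blast
  qed
qed

text \<open>
  With the number of boxes containing a cell as its height, every box \<open>S\<close> is an island: a box
  that contains a neighbor \<open>y\<close> of \<open>S\<close> is not separated from \<open>S\<close> and not inside \<open>S\<close>, so it contains
  \<open>S\<close>. Hence each cell of \<open>S\<close> lies in all the boxes that contain \<open>y\<close>, and in \<open>S\<close> besides.
\<close>

lemma spaced_family_point_islands:
  assumes "spaced_family (0, m, 0, n) F"
  shows "\<exists>h. card F \<le> num_islands point_adjacent m n h"
proof -
  have F: "finite F" "\<And>S. S \<in> F \<Longrightarrow> proper S" "\<And>S. S \<in> F \<Longrightarrow> cells S \<subseteq> cells (0, m, 0, n)"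
    "pairwise (\<lambda>S T. nested S T \<or> separated S T) F"
    using assms unfolding spaced_family_def by blast+
  define h where "h x = real (card {S \<in> F. x \<in> cells S})" for x
  have "rectangular_island point_adjacent m n h (cells S)" if S: "S \<in> F" for S
    unfolding rectangular_island_iff
  proof (intro conjI ballI)
    show "subrectangle m n (cells S)"
      using F(2,3)[OF S] unfolding subrectangle_iff_box by blast
    fix x y assume x: "x \<in> cells S" and "y \<in> neighbors point_adjacent m n (cells S)"
    then obtain z where z: "y \<notin> cells S" "z \<in> cells S" "point_adjacent y z"
      by (auto simp: neighbors_def)
    have "cells S \<subseteq> cells T" if T: "T \<in> F" "y \<in> cells T" for T
    proof -
      have "\<not> separated S T"
        using z T(2) by (cases S; cases T; cases y; cases z) (auto simp: point_adjacent_iff)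
      then have "nested S T"
        using pairwiseD[OF F(4) S T(1)] by (auto simp: nested_def)
      then show ?thesis using z T by (auto simp: nested_def)
    qed
    then have "{T \<in> F. y \<in> cells T} \<subset> {T \<in> F. x \<in> cells T}"
      using S x z by blast
    then have "card {T \<in> F. y \<in> cells T} < card {T \<in> F. x \<in> cells T}"
      using F(1) by (intro psubset_card_mono) auto
    then show "h y < h x" by (simp add: h_def)
  qed
  then have "cells ` F \<subseteq> {R. rectangular_island point_adjacent m n h R}" by blast
  then have "card (cells ` F) \<le> num_islands point_adjacent m n h"
    unfolding num_islands_def by (intro card_mono finite_islands)
  moreover have "inj_on cells F" by (rule inj_on_subset[OF inj_on_cells]) (use F in auto)
  ultimately show ?thesis by (auto simp: card_image)
qed

section \<open>Equality of the two maxima\<close>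

lemma num_islands_le_max: "num_islands adj m n h \<le> max_islands adj m n"
  unfolding max_islands_def by (rule Max_ge[OF finite_num_islands]) blast

lemma max_islands_leI:
  assumes "\<And>h. num_islands adj m n h \<le> k"
  shows "max_islands adj m n \<le> k"
  unfolding max_islands_def using assms by (subst Max_le_iff[OF finite_num_islands]) auto

text \<open>
  Fewer neighbors mean fewer conditions on an island.
\<close>

lemma max_islands_antimono:
  assumes "\<And>x y. adj x y \<Longrightarrow> adj' x y"
  shows "max_islands adj' m n \<le> max_islands adj m n"
proof (rule max_islands_leI)
  fix h
  have "{R. rectangular_island adj' m n h R} \<subseteq> {R. rectangular_island adj m n h R}"
    using assms unfolding rectangular_island_iff neighbors_def by blast
  then have "num_islands adj' m n h \<le> num_islands adj m n h"
    unfolding num_islands_def by (intro card_mono finite_islands)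
  then show "num_islands adj' m n h \<le> max_islands adj m n"
    using num_islands_le_max order_trans by blast
qed

theorem theorem11:
  fixes m n :: nat
  assumes "m \<ge> 1" and "n \<ge> 1"
  shows "islands_f_hat m n = islands_f m n"
proof (rule antisym)
  obtain F where F: "spaced_family (0, m, 0, n) F" "card (vertices (0, m, 0, n)) \<le> 2 * card F + 3"
    using large_spaced_family_exists[of "(0, m, 0, n)"] assms by auto
  then have "(m + 1) * (n + 1) \<le> 2 * card F + 3" by (simp add: card_cartesian_product)
  moreover obtain h where "card F \<le> num_islands point_adjacent m n h"
    using spaced_family_point_islands[OF F(1)] by blast
  then have "card F \<le> islands_f m n"
    unfolding islands_f_def using num_islands_le_max order_trans by blast
  ultimately have low: "(m + 1) * (n + 1) \<le> 2 * islands_f m n + 3" by linarith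
  show "islands_f_hat m n \<le> islands_f m n"
    unfolding islands_f_hat_def
  proof (rule max_islands_leI)
    fix h
    show "num_islands side_adjacent m n h \<le> islands_f m n"
      using num_side_islands_le[OF assms, of h] low by linarith
  qed
  show "islands_f m n \<le> islands_f_hat m n"
    unfolding islands_f_def islands_f_hat_def
  proof (rule max_islands_antimono)
    fix x y assume "side_adjacent x y"
    then show "point_adjacent x y"
      by (cases x; cases y) (auto simp: side_adjacent_iff point_adjacent_iff)
  qed
qed

end
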